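(* Let $\mathcal{H}\cong\mathbb{C}^n$, let $\mathbf{H}$ be a self-adjoint operator on $\mathcal{H}$, let $\mathbf{v}_1,\dots,\mathbf{v}_N\in\mathcal{B}(\mathcal{H})$ with $N\le n^2-1$, and put $\mathbf{V}=\sum_{j=1}^N\mathbf{v}_j^\dagger\mathbf{v}_j$ and $\mathcal{K}(\xi)=\sum_{j=1}^N\mathbf{v}_j\,\xi\,\mathbf{v}_j^\dagger$. Let $$\mathbf{L}(\xi)=-2[[\mathbf{H},\xi]]-\mathbf{V}\odot\xi+\mathcal{K}(\xi)$$ be the corresponding GKLS generator, acting on $\mathfrak{O}^*$, and let $\widetilde{\Gamma}=\mathbb{Z}_{\mathbf{L}}$ be the linear vector field on $\mathfrak{O}^*$ associated with $\mathbf{L}$. Then $\widetilde{\Gamma}$ defines a derivation, say $\Gamma$, of the algebra $\mathcal{F}(\mathfrak{T}_1)$. Furthermore, $\Gamma$ decomposes into the sum of three vector fields, all of which, separately, define derivations of $\mathcal{F}(\mathfrak{T}_1)$. Specifically, $$\Gamma=X_{\mathbf{a}}+Y_{\mathbf{b}}+Z_{\mathcal{K}},$$ where $X_{\mathbf{a}}$ is the Hamiltonian vector field associated with $\mathbf{a}=-2\mathbf{H}$, $Y_{\mathbf{b}}$ is the gradient-like vector field associated with $\mathbf{b}=-\mathbf{V}=-\sum_j\mathbf{v}_j^\dagger\mathbf{v}_j$, and $Z_{\mathcal{K}}$ is the vector field on $\mathfrak{T}_1$ associated with the linear map $\mathcal{K}$.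
   Context: $\mathfrak{O}$ is the real vector space of self-adjoint operators on $\mathcal{H}\cong\mathbb{C}^n$, and its dual $\mathfrak{O}^*$ is identified with self-adjoint $n\times n$ matrices through $\xi(\mathbf{a})=\mathrm{Tr}(\xi\mathbf{a})$. Products: $\mathbf{a}\odot\mathbf{b}=\frac12(\mathbf{ab}+\mathbf{ba})$ and $[[\mathbf{a},\mathbf{b}]]=\frac{i}{2}(\mathbf{ab}-\mathbf{ba})$. For $\mathbf{a}\in\mathfrak{O}$, $f_{\mathbf{a}}(\xi)=\mathrm{Tr}(\xi\mathbf{a})$; the same symbol denotes its restriction to $\mathfrak{T}_1$. Let $\{\mathbf{e}^\mu\}_{\mu=0}^{n^2-1}$ be a basis of $\mathfrak{O}$ orthonormal for the trace inner product with $\mathbf{e}^0=\mathbb{I}/\sqrt n$, let $\{\mathbf{e}_\mu\}$ be the dual basis of $\mathfrak{O}^*$, and let $x^\mu=f_{\mathbf{e}^\mu}$ be the associated Cartesian coordinates on $\mathfrak{O}^*$. Greek indices run over $0,\dots,n^2-1$, Latin indices over $1,\dots,n^2-1$; repeated indices are summed. $\mathfrak{T}_1=\{\xi\in\mathfrak{O}^*:\mathrm{Tr}\,\xi=1\}$ is the affine hyperplane $x^0=1/\sqrt n$, with coordinates $(x^k)_{k\ge1}$. $\mathcal{F}(\cdot)$ denotes smooth functions, and $\mathcal{I}_{\mathfrak{T}_1}\subset\mathcal{F}(\mathfrak{O}^* )$ is the ideal of functions vanishing on $\mathfrak{T}_1$, so $\mathcal{F}(\mathfrak{T}_1)\cong\mathcal{F}(\mathfrak{O}^*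 )/\mathcal{I}_{\mathfrak{T}_1}$. A vector field $\widetilde D$ on $\mathfrak{O}^*$ "defines a derivation of $\mathcal{F}(\mathfrak{T}_1)$" if $\widetilde D(\mathcal{I}_{\mathfrak{T}_1})\subset\mathcal{I}_{\mathfrak{T}_1}$; the induced derivation (a vector field on $\mathfrak{T}_1$) is $D([f])=[\widetilde D(f)]$. The linear vector field on $\mathfrak{O}^*$ associated with a linear map $A(\xi)=A^\mu_\nu\xi^\nu\mathbf{e}_\mu$ of $\mathfrak{O}^*$ into itself is $\mathbb{Z}_A=A^\mu_\nu x^\nu\frac{\partial}{\partial x^\mu}$. Vector fields on $\mathfrak{T}_1$: let $\Delta=x^k\frac{\partial}{\partial x^k}$. The Hamiltonian vector field $X_{\mathbf{a}}$ is determined by $X_{\mathbf{a}}(f_{\mathbf{c}})=f_{[[\mathbf{a},\mathbf{c}]]}$ and the gradient-like vector field $Y_{\mathbf{b}}$ by $Y_{\mathbf{b}}(f_{\mathbf{c}})=f_{\mathbf{b}\odot\mathbf{c}}-f_{\mathbf{b}}f_{\mathbf{c}}$, for all $\mathbf{c}\in\mathfrak{O}$. The vector field associated with $\mathcal{K}$ is $$Z_{\mathcal{K}}=\mathrm{Tr}(\mathcal{K}(\mathbf{e}_\mu)\mathbf{e}^k)\,x^\mu\frac{\partial}{\partial x^k}-f_{\mathbf{V}}\Delta,\qquad x^0=\tfrac1{\sqrt n}.$$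
   Formalization: The Hamiltonian vector field is taken with a = +2H instead of the printed a = −2H, because with the stated definitions of L, [[·,·]] and X_a the printed sign is false unless H is a multiple of the identity. *)

theory Defs
  imports "HOL-Analysis.Analysis"
begin

section \<open>Self-adjoint matrices as a Euclidean space\<close>

definition dagger :: "complex^'n^'n \<Rightarrow> complex^'n^'n" where
  "dagger A = (\<chi> i j. cnj (A $ j $ i))"

lemma dagger_simps:
  "dagger 0 = 0" "dagger (A + B) = dagger A + dagger B" "dagger (A - B) = dagger A - dagger B"
  "dagger (- A) = - dagger A" "dagger (r *\<^sub>R A) = r *\<^sub>R dagger A" "dagger (dagger A) = A"
  "dagger (A ** B) = dagger B ** dagger A" "dagger (mat 1) = mat 1"
  by (auto simp: dagger_def vec_eq_iff matrix_matrix_mult_def mat_def mult.commute)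

lemma dagger_sum: "dagger (\<Sum>i\<in>I. A i) = (\<Sum>i\<in>I. dagger (A i))"
  by (induction I rule: infinite_finite_induct) (simp_all add: dagger_simps)

text \<open>
  The space of observables and its dual are both represented by this type: the identification is
  the pairing \<open>\<xi>(a) = Tr (\<xi> a)\<close>, the function \<open>obs a\<close> below.
\<close>

typedef 'n herm = "{A :: complex^'n^'n. dagger A = A}"
  morphisms mat_of herm_of
  by (intro exI[of _ 0]) (simp add: dagger_simps)

setup_lifting type_definition_herm

instantiation herm :: (finite) real_vector
begin
lift_definition zero_herm :: "'a herm" is 0 by (simp add: dagger_simps)
lift_definition plus_herm :: "'a herm \<Rightarrow> 'a herm \<Rightarrow> 'a herm" is "(+)" by (simp add: dagger_simps)
lift_definition minus_herm :: "'a herm \<Rightarrow> 'a herm \<Rightarrow> 'a herm" is "(-)" by (simp add: dagger_simps)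
lift_definition uminus_herm :: "'a herm \<Rightarrow> 'a herm" is uminus by (simp add: dagger_simps)
lift_definition scaleR_herm :: "real \<Rightarrow> 'a herm \<Rightarrow> 'a herm" is scaleR by (simp add: dagger_simps)
instance
  by standard (transfer; simp add: algebra_simps)+
end

instantiation herm :: (finite) real_inner
begin
lift_definition inner_herm :: "'a herm \<Rightarrow> 'a herm \<Rightarrow> real" is inner .
definition norm_herm :: "'a herm \<Rightarrow> real" where "norm_herm x = sqrt (inner x x)"
definition dist_herm :: "'a herm \<Rightarrow> 'a herm \<Rightarrow> real" where "dist_herm x y = norm (x - y)"
definition sgn_herm :: "'a herm \<Rightarrow> 'a herm" where "sgn_herm x = x /\<^sub>R norm x"
definition uniformity_herm :: "('a herm \<times> 'a herm) filter" where
  "uniformity_herm = (INF e\<in>{0 <..}. principal {(x, y). dist x y < e})"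
definition open_herm :: "'a herm set \<Rightarrow> bool" where
  "open_herm U \<longleftrightarrow> (\<forall>x\<in>U. eventually (\<lambda>(x', y). x' = x \<longrightarrow> y \<in> U) uniformity)"
instance
proof
  fix x y z :: "'a herm" and r :: real
  show "inner x y = inner y x" by transfer (rule inner_commute)
  show "inner (x + y) z = inner x z + inner y z" by transfer (rule inner_add_left)
  show "inner (r *\<^sub>R x) y = r * inner x y" by transfer simp
  show "0 \<le> inner x x" by transfer simp
  show "inner x x = 0 \<longleftrightarrow> x = 0" by transfer simp
qed (simp_all add: norm_herm_def dist_herm_def sgn_herm_def uniformity_herm_def open_herm_def)
end

lemma orthonormal_basis_herm_exists:
  "\<exists>B :: 'n::finite herm set. finite B \<and> B \<noteq> {} \<and>
    (\<forall>u\<in>B. \<forall>w\<in>B. inner u w = (if u = w then 1 else 0)) \<and>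
    (\<forall>x. (\<forall>u\<in>B. inner x u = 0) \<longleftrightarrow> x = 0)"
proof -
  let ?S = "{A :: complex^'n^'n. dagger A = A}"
  have "subspace ?S" by (simp add: subspace_def dagger_simps)
  then obtain B where B: "B \<subseteq> ?S" "pairwise orthogonal B" "\<And>x. x \<in> B \<Longrightarrow> norm x = 1"
    "independent B" "span B = ?S"
    by (elim orthonormal_basis_subspace) auto
  have fin: "finite B" using B(4) independent_imp_finite by blast
  have rep: "mat_of (herm_of b) = b" if "b \<in> B" for b
    using that B(1) by (subst herm_of_inverse) auto
  have ort: "inner b c = (if b = c then 1 else 0)" if "b \<in> B" "c \<in> B" for b c
  proof (cases "b = c")
    case True
    thus ?thesis using B(3)[OF that(1)] by (simp add: norm_eq_1)
  next
    case False
    thus ?thesis using B(2) that by (simp add: pairwise_def orthogonal_def)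
  qed
  have one: "mat 1 \<in> ?S" by (simp add: dagger_simps)
  have "mat 1 \<noteq> (0 :: complex^'n^'n)" by (auto simp: vec_eq_iff mat_def)
  hence ne: "B \<noteq> {}" using one B(5) by auto
  have zero: "x = 0" if "\<forall>u\<in>herm_of ` B. inner x u = 0" for x :: "'n herm"
  proof -
    have o: "orthogonal (mat_of x) b" if "b \<in> B" for b
      using that \<open>\<forall>u\<in>herm_of ` B. inner x u = 0\<close> rep by (auto simp: inner_herm.rep_eq orthogonal_def)
    have "mat_of x \<in> span B" using mat_of[of x] B(5) by simp
    from orthogonal_to_span[OF this o] have "orthogonal (mat_of x) (mat_of x)" .
    thus ?thesis by (simp add: orthogonal_def inner_herm.rep_eq[symmetric])
  qed
  have orth2: "\<forall>u\<in>herm_of ` B. \<forall>w\<in>herm_of ` B. inner u w = (if u = w then 1 else 0)"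
  proof (intro ballI)
    fix u w assume "u \<in> herm_of ` B" "w \<in> herm_of ` B"
    then obtain b c where bc: "b \<in> B" "c \<in> B" "u = herm_of b" "w = herm_of c" by blast
    have "u = w \<longleftrightarrow> b = c" using bc rep by metis
    thus "inner u w = (if u = w then 1 else 0)"
      using bc ort rep by (simp add: inner_herm.rep_eq)
  qed
  show ?thesis
    using fin ne orth2 zero by (intro exI[of _ "herm_of ` B"]) auto
qed

instantiation herm :: (finite) euclidean_space
begin
definition Basis_herm :: "'a herm set" where
  "Basis_herm = (SOME B. finite B \<and> B \<noteq> {} \<and>
    (\<forall>u\<in>B. \<forall>w\<in>B. inner u w = (if u = w then 1 else 0)) \<and>
    (\<forall>x. (\<forall>u\<in>B. inner x u = 0) \<longleftrightarrow> x = 0))"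
instance
  using someI_ex[OF orthonormal_basis_herm_exists[where 'n = 'a], folded Basis_herm_def]
  by intro_classes (simp_all)
end


section \<open>Products and linear functions\<close>

lift_definition id_herm :: "'n::finite herm" is "mat 1" by (simp add: dagger_simps)

lift_definition jordan_prod :: "'n::finite herm \<Rightarrow> 'n herm \<Rightarrow> 'n herm"
  is "\<lambda>a b. (1/2) *\<^sub>R (a ** b + b ** a)"
  by (simp add: dagger_simps add.commute)

lift_definition lie_prod :: "'n::finite herm \<Rightarrow> 'n herm \<Rightarrow> 'n herm"
  is "\<lambda>a b. (\<chi> i j. \<i> / 2 * (a ** b - b ** a) $ i $ j)"
proof -
  fix a b :: "complex^'n^'n"
  assume "dagger a = a" "dagger b = b"
  hence "dagger (a ** b - b ** a) = b ** a - a ** b" by (simp add: dagger_simps)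
  hence "cnj ((a ** b - b ** a) $ j $ i) = - ((a ** b - b ** a) $ i $ j)" for i j
    by (simp add: dagger_def vec_eq_iff)
  thus "dagger (\<chi> i j. \<i> / 2 * (a ** b - b ** a) $ i $ j) = (\<chi> i j. \<i> / 2 * (a ** b - b ** a) $ i $ j)"
    by (simp add: dagger_def vec_eq_iff del: vector_minus_component)
qed

definition herm_trace :: "'n::finite herm \<Rightarrow> real" where
  "herm_trace \<xi> = Re (trace (mat_of \<xi>))"

definition obs :: "'n::finite herm \<Rightarrow> 'n herm \<Rightarrow> real" where
  "obs a \<xi> = Re (trace (mat_of \<xi> ** mat_of a))"

text \<open>The real parts above lose nothing, and the trace inner product is the inner product of the type.\<close>

lemma trace_dagger: "trace (dagger A) = cnj (trace A)"
  by (simp add: trace_def dagger_def)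

lemma dagger_mat_of [simp]: "dagger (mat_of a) = mat_of a"
  using mat_of[of a] by simp

lemma trace_mat_of_real: "trace (mat_of \<xi>) = complex_of_real (herm_trace \<xi>)"
  using trace_dagger[of "mat_of \<xi>"] by (auto simp: herm_trace_def complex_eq_iff)

lemma trace_mult_real: "trace (mat_of \<xi> ** mat_of a) = complex_of_real (obs a \<xi>)"
proof -
  have "cnj (trace (mat_of \<xi> ** mat_of a)) = trace (mat_of a ** mat_of \<xi>)"
    by (simp only: trace_dagger[symmetric] dagger_simps dagger_mat_of)
  also have "\<dots> = trace (mat_of \<xi> ** mat_of a)" by (rule trace_mul_sym)
  finally show ?thesis by (simp add: obs_def complex_eq_iff)
qed

lemma obs_eq_inner: "obs a \<xi> = inner \<xi> a"
proof -
  have d: "cnj (mat_of \<xi> $ i $ j) = mat_of \<xi> $ j $ i" for i j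
    using arg_cong[OF dagger_mat_of[of \<xi>], of "\<lambda>A. A $ j $ i"] by (simp add: dagger_def)
  have "obs a \<xi> = (\<Sum>i\<in>UNIV. \<Sum>k\<in>UNIV. Re (mat_of \<xi> $ i $ k * mat_of a $ k $ i))"
    by (simp add: obs_def trace_def matrix_matrix_mult_def)
  also have "\<dots> = (\<Sum>k\<in>UNIV. \<Sum>i\<in>UNIV. Re (mat_of \<xi> $ i $ k * mat_of a $ k $ i))"
    by (rule sum.swap)
  also have "\<dots> = (\<Sum>k\<in>UNIV. \<Sum>i\<in>UNIV. Re (cnj (mat_of \<xi> $ k $ i) * mat_of a $ k $ i))"
    by (simp add: d)
  also have "\<dots> = inner \<xi> a"
    by (simp add: inner_herm.rep_eq inner_vec_def inner_complex_def)
  finally show ?thesis .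
qed

lemma herm_trace_eq_obs: "herm_trace \<xi> = obs id_herm \<xi>"
  by (simp add: herm_trace_def obs_def id_herm.rep_eq)


section \<open>The GKLS generator\<close>

text \<open>The jump operators are \<open>v 1, \<dots>, v N\<close>.\<close>

lift_definition kraus_sum :: "(nat \<Rightarrow> complex^'n::finite^'n) \<Rightarrow> nat \<Rightarrow> 'n herm"
  is "\<lambda>v N. \<Sum>j=1..N. dagger (v j) ** v j"
  by (simp add: dagger_sum dagger_simps)

lift_definition kraus_map :: "(nat \<Rightarrow> complex^'n::finite^'n) \<Rightarrow> nat \<Rightarrow> 'n herm \<Rightarrow> 'n herm"
  is "\<lambda>v N \<xi>. \<Sum>j=1..N. v j ** \<xi> ** dagger (v j)"
  by (simp add: dagger_sum dagger_simps matrix_mul_assoc)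

definition gkls :: "'n::finite herm \<Rightarrow> (nat \<Rightarrow> complex^'n^'n) \<Rightarrow> nat \<Rightarrow> 'n herm \<Rightarrow> 'n herm" where
  "gkls H v N \<xi> = - (2 *\<^sub>R lie_prod H \<xi>) - jordan_prod (kraus_sum v N) \<xi> + kraus_map v N \<xi>"


section \<open>Smooth functions and vector fields on the dual\<close>

primrec Cn :: "nat \<Rightarrow> ('a::euclidean_space \<Rightarrow> 'b::real_normed_vector) \<Rightarrow> bool" where
  "Cn 0 f \<longleftrightarrow> continuous_on UNIV f"
| "Cn (Suc k) f \<longleftrightarrow> (\<forall>x. f differentiable (at x)) \<and>
     (\<forall>w. Cn k (\<lambda>x. frechet_derivative f (at x) w))"

definition smooth :: "('a::euclidean_space \<Rightarrow> 'b::real_normed_vector) \<Rightarrow> bool" where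
  "smooth f \<longleftrightarrow> (\<forall>k. Cn k f)"

definition F_dual :: "('n::finite herm \<Rightarrow> real) set" where
  "F_dual = {f. smooth f}"

text \<open>A vector field is given by its components, a map into the model space; it acts on functions as
  a first-order differential operator.\<close>

definition vf_apply :: "('n::finite herm \<Rightarrow> 'n herm) \<Rightarrow> ('n herm \<Rightarrow> real) \<Rightarrow> 'n herm \<Rightarrow> real" where
  "vf_apply V f \<xi> = frechet_derivative f (at \<xi>) (V \<xi>)"


section \<open>The hyperplane of unit trace\<close>

definition T1 :: "'n::finite herm set" where
  "T1 = {\<xi>. herm_trace \<xi> = 1}"

definition ideal_T1 :: "('n::finite herm \<Rightarrow> real) set" where
  "ideal_T1 = {f \<in> F_dual. \<forall>\<xi>\<in>T1. f \<xi> = 0}"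

text \<open>
  The class of \<open>f\<close> modulo \<open>ideal_T1\<close> is represented by the restriction of \<open>f\<close> to \<open>T1\<close>
  (\<open>undefined\<close> outside \<open>T1\<close>).
\<close>

definition F_T1 :: "('n::finite herm \<Rightarrow> real) set" where
  "F_T1 = (\<lambda>f. restrict f T1) ` F_dual"

definition defines_derivation :: "('n::finite herm \<Rightarrow> 'n herm) \<Rightarrow> bool" where
  "defines_derivation V \<longleftrightarrow> smooth V \<and> vf_apply V ` ideal_T1 \<subseteq> ideal_T1"

text \<open>\<open>D [f] = [V f]\<close>; the choice of representative is immaterial if \<open>defines_derivation V\<close>.\<close>

definition induced_derivation ::
    "('n::finite herm \<Rightarrow> 'n herm) \<Rightarrow> ('n herm \<Rightarrow> real) \<Rightarrow> 'n herm \<Rightarrow> real" where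
  "induced_derivation V F =
     restrict (vf_apply V (SOME f. f \<in> F_dual \<and> restrict f T1 = F)) T1"

definition derivation_T1 :: "(('n::finite herm \<Rightarrow> real) \<Rightarrow> 'n herm \<Rightarrow> real) \<Rightarrow> bool" where
  "derivation_T1 D \<longleftrightarrow>
     (\<forall>F\<in>F_T1. D F \<in> F_T1) \<and>
     (\<forall>F\<in>F_T1. \<forall>G\<in>F_T1. D (\<lambda>\<xi>\<in>T1. F \<xi> + G \<xi>) = (\<lambda>\<xi>\<in>T1. D F \<xi> + D G \<xi>)) \<and>
     (\<forall>F\<in>F_T1. \<forall>r. D (\<lambda>\<xi>\<in>T1. r * F \<xi>) = (\<lambda>\<xi>\<in>T1. r * D F \<xi>)) \<and>
     (\<forall>F\<in>F_T1. \<forall>G\<in>F_T1. D (\<lambda>\<xi>\<in>T1. F \<xi> * G \<xi>) = (\<lambda>\<xi>\<in>T1. D F \<xi> * G \<xi> + F \<xi> * D G \<xi>))"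

text \<open>
  Vector fields on \<open>T1\<close>: smooth maps on \<open>T1\<close> with values in its direction space, the traceless
  matrices. If \<open>X \<xi>\<close> is traceless then the line \<open>\<xi> + t X \<xi>\<close> stays in \<open>T1\<close>, so the action below only
  uses values on \<open>T1\<close>.
\<close>

definition vf_T1 :: "('n::finite herm \<Rightarrow> 'n herm) set" where
  "vf_T1 = {X \<in> (\<lambda>V. restrict V T1) ` {V. smooth V}. \<forall>\<xi>\<in>T1. herm_trace (X \<xi>) = 0}"

definition vf1_apply :: "('n::finite herm \<Rightarrow> 'n herm) \<Rightarrow> ('n herm \<Rightarrow> real) \<Rightarrow> 'n herm \<Rightarrow> real" where
  "vf1_apply X F = (\<lambda>\<xi>\<in>T1. deriv (\<lambda>t. F (\<xi> + t *\<^sub>R X \<xi>)) 0)"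

definition hamiltonian_vf :: "'n::finite herm \<Rightarrow> 'n herm \<Rightarrow> 'n herm" where
  "hamiltonian_vf a = (THE X. X \<in> vf_T1 \<and>
     (\<forall>c. vf1_apply X (restrict (obs c) T1) = restrict (obs (lie_prod a c)) T1))"

definition gradient_vf :: "'n::finite herm \<Rightarrow> 'n herm \<Rightarrow> 'n herm" where
  "gradient_vf b = (THE Y. Y \<in> vf_T1 \<and>
     (\<forall>c. vf1_apply Y (restrict (obs c) T1) =
       (\<lambda>\<xi>\<in>T1. obs (jordan_prod b c) \<xi> - obs b \<xi> * obs c \<xi>)))"


section \<open>Cartesian coordinates\<close>

text \<open>
  \<open>e \<mu>\<close> is the upper-index basis of the observables, \<open>d \<mu>\<close> the dual (lower-index) basis;
  the coordinates are \<open>x\<^sup>\<mu> = obs (e \<mu>)\<close> and \<open>\<partial>/\<partial>x\<^sup>\<mu>\<close> is the constant vector field \<open>d \<mu>\<close>.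
\<close>

definition trace_orthonormal_basis :: "(nat \<Rightarrow> 'n::finite herm) \<Rightarrow> bool" where
  "trace_orthonormal_basis e \<longleftrightarrow>
     (\<forall>\<mu><CARD('n)\<^sup>2. \<forall>\<nu><CARD('n)\<^sup>2. trace (mat_of (e \<mu>) ** mat_of (e \<nu>)) = (if \<mu> = \<nu> then 1 else 0)) \<and>
     span (e ` {..<CARD('n)\<^sup>2}) = UNIV"

definition dual_basis :: "(nat \<Rightarrow> 'n::finite herm) \<Rightarrow> (nat \<Rightarrow> 'n herm) \<Rightarrow> bool" where
  "dual_basis e d \<longleftrightarrow>
     (\<forall>\<mu><CARD('n)\<^sup>2. \<forall>\<nu><CARD('n)\<^sup>2. obs (e \<nu>) (d \<mu>) = (if \<mu> = \<nu> then 1 else 0))"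

text \<open>The matrix entry \<open>A\<^sup>\<mu>\<^sub>\<nu>\<close> is \<open>obs (e \<mu>) (A (d \<nu>))\<close>.\<close>

definition linear_vf ::
    "(nat \<Rightarrow> 'n::finite herm) \<Rightarrow> (nat \<Rightarrow> 'n herm) \<Rightarrow> ('n herm \<Rightarrow> 'n herm) \<Rightarrow> 'n herm \<Rightarrow> 'n herm" where
  "linear_vf e d A \<xi> =
     (\<Sum>\<mu><CARD('n)\<^sup>2. \<Sum>\<nu><CARD('n)\<^sup>2. (obs (e \<mu>) (A (d \<nu>)) * obs (e \<nu>) \<xi>) *\<^sub>R d \<mu>)"

definition dilation_vf ::
    "(nat \<Rightarrow> 'n::finite herm) \<Rightarrow> (nat \<Rightarrow> 'n herm) \<Rightarrow> 'n herm \<Rightarrow> 'n herm" where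
  "dilation_vf e d = (\<lambda>\<xi>\<in>T1. \<Sum>k=1..<CARD('n)\<^sup>2. obs (e k) \<xi> *\<^sub>R d k)"

text \<open>On \<open>T1\<close> the coordinate \<open>x\<^sup>0 = obs (e 0)\<close> has the value \<open>1 / sqrt n\<close> when \<open>e 0 = I / sqrt n\<close>.\<close>

definition jump_vf ::
    "(nat \<Rightarrow> 'n::finite herm) \<Rightarrow> (nat \<Rightarrow> 'n herm) \<Rightarrow> ('n herm \<Rightarrow> 'n herm) \<Rightarrow> 'n herm \<Rightarrow>
     'n herm \<Rightarrow> 'n herm" where
  "jump_vf e d K V = (\<lambda>\<xi>\<in>T1.
     (\<Sum>k=1..<CARD('n)\<^sup>2. \<Sum>\<mu><CARD('n)\<^sup>2. (obs (e k) (K (d \<mu>)) * obs (e \<mu>) \<xi>) *\<^sub>R d k)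
     - obs V \<xi> *\<^sub>R dilation_vf e d \<xi>)"


section \<open>The Hamiltonian and gradient-like fields are well defined\<close>

text \<open>
  The pairing turns \<open>lie_prod a\<close> into \<open>- lie_prod a\<close>. Hence the field with
  \<open>X (obs c) = obs (lie_prod a c)\<close> has the value \<open>- lie_prod a \<xi>\<close> at \<open>\<xi>\<close>, and the summand
  \<open>- 2 lie_prod H \<xi>\<close> of \<open>gkls\<close> is the Hamiltonian field of \<open>2 H\<close>.
\<close>

lemma trace_scale_left: "trace ((\<chi> i j. k * M $ i $ j) ** C) = k * trace (M ** C)"
  for M C :: "complex^'n^'n"
  by (simp add: trace_def matrix_matrix_mult_def sum_distrib_left mult.assoc)

lemma trace_scale_right: "trace (C ** (\<chi> i j. k * M $ i $ j)) = k * trace (C ** M)"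
  for M C :: "complex^'n^'n"
  by (simp add: trace_def matrix_matrix_mult_def sum_distrib_left mult_ac)

lemma matrix_scaleR_left: "(r *\<^sub>R A) ** B = r *\<^sub>R (A ** B)"
  and matrix_scaleR_right: "A ** (r *\<^sub>R B) = r *\<^sub>R (A ** B)"
  for A B :: "complex^'n^'n"
  by (simp_all add: vec_eq_iff matrix_matrix_mult_def scaleR_sum_right)

lemma trace_scaleR: "trace (r *\<^sub>R M) = r *\<^sub>R trace M" for M :: "complex^'n^'n"
  by (simp add: trace_def scaleR_sum_right)

lemma matrix_mult_distribs:
  "A ** (B + C) = A ** B + A ** C" "(B + C) ** A = B ** A + C ** A"
  "A ** (B - C) = A ** B - A ** C" "(B - C) ** A = B ** A - C ** A"
  for A B C :: "complex^'n^'n"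
  by (simp_all add: vec_eq_iff matrix_matrix_mult_def algebra_simps sum.distrib sum_subtractf)

lemma obs_lie_prod: "obs c (lie_prod a \<xi>) = - obs (lie_prod a c) \<xi>"
proof -
  let ?a = "mat_of a" and ?x = "mat_of \<xi>" and ?c = "mat_of c"
  have 1: "trace (?x ** (?a ** ?c)) = trace ((?x ** ?a) ** ?c)" by (simp add: matrix_mul_assoc)
  have 2: "trace (?x ** (?c ** ?a)) = trace ((?a ** ?x) ** ?c)"
    using trace_mul_sym[of "?x ** ?c" ?a] by (simp add: matrix_mul_assoc)
  have "trace ((?a ** ?x - ?x ** ?a) ** ?c) = - trace (?x ** (?a ** ?c - ?c ** ?a))"
    by (simp add: matrix_mult_distribs trace_sub 1 2)
  thus ?thesis
    by (simp only: obs_def lie_prod.rep_eq trace_scale_left trace_scale_right) simp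
qed

lemma obs_jordan_prod: "obs c (jordan_prod b \<xi>) = obs (jordan_prod b c) \<xi>"
proof -
  let ?a = "mat_of b" and ?x = "mat_of \<xi>" and ?c = "mat_of c"
  have 1: "trace (?x ** (?a ** ?c)) = trace ((?x ** ?a) ** ?c)" by (simp add: matrix_mul_assoc)
  have 2: "trace (?x ** (?c ** ?a)) = trace ((?a ** ?x) ** ?c)"
    using trace_mul_sym[of "?x ** ?c" ?a] by (simp add: matrix_mul_assoc)
  have "trace ((?a ** ?x + ?x ** ?a) ** ?c) = trace (?x ** (?a ** ?c + ?c ** ?a))"
    by (simp add: matrix_mult_distribs trace_add 1 2)
  thus ?thesis
    by (simp add: obs_def jordan_prod.rep_eq matrix_scaleR_left matrix_scaleR_right trace_scaleR)
qed

lemma Cn_const: "Cn k (\<lambda>x. c)"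
  by (induction k arbitrary: c) simp_all

lemma Cn_linear: "bounded_linear f \<Longrightarrow> Cn k f"
  by (cases k) (auto simp: Cn_const linear_continuous_on bounded_linear_imp_differentiable
      frechet_derivative_at[OF bounded_linear_imp_has_derivative, symmetric])

lemma Cn_Suc_imp: "Cn (Suc k) f \<Longrightarrow> Cn k f"
proof (induction k arbitrary: f)
  case 0
  thus ?case by (auto simp: continuous_on_eq_continuous_at differentiable_imp_continuous_within)
next
  case (Suc k)
  thus ?case by (subst Cn.simps) (metis Cn.simps(2))
qed

lemma Cn_add: "Cn k f \<Longrightarrow> Cn k g \<Longrightarrow> Cn k (\<lambda>x. f x + g x)"
proof (induction k arbitrary: f g)
  case 0
  thus ?case by (auto intro: continuous_intros)
next
  case (Suc k)
  have "frechet_derivative (\<lambda>x. f x + g x) (at x) = (\<lambda>h. frechet_derivative f (at x) h + frechet_derivative g (at x) h)" for x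
    using Suc.prems by (intro frechet_derivative_at[symmetric] has_derivative_add)
      (auto simp: frechet_derivative_works)
  thus ?case using Suc by auto
qed

lemma Cn_scaleR: "Cn k f \<Longrightarrow> Cn k g \<Longrightarrow> Cn k (\<lambda>x. f x *\<^sub>R g x)"
proof (induction k arbitrary: f g)
  case 0
  thus ?case by (auto intro: continuous_intros)
next
  case (Suc k)
  have d: "((\<lambda>x. f x *\<^sub>R g x) has_derivative (\<lambda>h. f x *\<^sub>R frechet_derivative g (at x) h + frechet_derivative f (at x) h *\<^sub>R g x)) (at x)" for x
    using Suc.prems by (intro has_derivative_scaleR) (auto simp: frechet_derivative_works)
  have "Cn k f" "Cn k g" using Suc.prems Cn_Suc_imp by blast+
  thus ?case using Suc d frechet_derivative_at[OF d, symmetric]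
    by (auto simp: differentiable_def intro!: Cn_add Suc.IH)
qed

lemma obs_add: "obs a (\<xi> + \<eta>) = obs a \<xi> + obs a \<eta>"
  and obs_diff: "obs a (\<xi> - \<eta>) = obs a \<xi> - obs a \<eta>"
  and obs_minus: "obs a (- \<xi>) = - obs a \<xi>"
  and obs_scaleR: "obs a (r *\<^sub>R \<xi>) = r * obs a \<xi>"
  by (simp_all add: obs_eq_inner inner_simps)

lemma obs_ext: "(\<And>c. obs c \<xi> = obs c \<eta>) \<Longrightarrow> \<xi> = \<eta>"
  by (simp add: obs_eq_inner) (metis inner_commute vector_eq_ldot)

lemma bounded_linear_lie_prod: "bounded_linear (lie_prod a)"
  unfolding linear_conv_bounded_linear[symmetric]
  by (intro linearI obs_ext) (simp_all add: obs_lie_prod obs_add obs_scaleR)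

lemma bounded_linear_jordan_prod: "bounded_linear (jordan_prod a)"
  unfolding linear_conv_bounded_linear[symmetric]
  by (intro linearI obs_ext) (simp_all add: obs_jordan_prod obs_add obs_scaleR)

lemma bounded_linear_obs: "bounded_linear (obs a)"
  unfolding obs_eq_inner[abs_def] by (rule bounded_linear_inner_left)

lemma vf1_apply_obs:
  assumes "X \<in> vf_T1"
  shows "vf1_apply X (restrict (obs c) T1) = (\<lambda>\<xi>\<in>T1. obs c (X \<xi>))"
proof -
  have "deriv (\<lambda>t. restrict (obs c) T1 (\<xi> + t *\<^sub>R X \<xi>)) 0 = obs c (X \<xi>)" if "\<xi> \<in> T1" for \<xi>
  proof -
    have "\<xi> + t *\<^sub>R X \<xi> \<in> T1" for t
      using assms that by (auto simp: vf_T1_def T1_def herm_trace_eq_obs obs_add obs_scaleR)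
    hence "(\<lambda>t. restrict (obs c) T1 (\<xi> + t *\<^sub>R X \<xi>)) = (\<lambda>t. obs c \<xi> + t * obs c (X \<xi>))"
      by (simp add: obs_add obs_scaleR)
    moreover have "((\<lambda>t. obs c \<xi> + t * obs c (X \<xi>)) has_real_derivative obs c (X \<xi>)) (at 0)"
      by (auto intro!: derivative_eq_intros)
    ultimately show ?thesis by (simp add: DERIV_imp_deriv)
  qed
  thus ?thesis by (auto simp: vf1_apply_def restrict_def)
qed

lemma vf_T1_ext:
  assumes "X \<in> vf_T1" "Y \<in> vf_T1"
    and "\<And>c. vf1_apply X (restrict (obs c) T1) = vf1_apply Y (restrict (obs c) T1)"
  shows "X = Y"
proof (rule extensionalityI[of _ T1])
  show "X \<in> extensional T1" "Y \<in> extensional T1" using assms by (auto simp: vf_T1_def)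
  show "X \<xi> = Y \<xi>" if "\<xi> \<in> T1" for \<xi>
  proof (rule obs_ext)
    fix c
    from assms(3)[of c] have "restrict (\<lambda>\<xi>. obs c (X \<xi>)) T1 \<xi> = restrict (\<lambda>\<xi>. obs c (Y \<xi>)) T1 \<xi>"
      unfolding vf1_apply_obs[OF assms(1)] vf1_apply_obs[OF assms(2)] by simp
    thus "obs c (X \<xi>) = obs c (Y \<xi>)" using that by simp
  qed
qed

lemma lie_prod_id: "lie_prod a id_herm = 0"
  by transfer (simp add: vec_eq_iff)

lemma jordan_prod_id: "jordan_prod a id_herm = a"
  by transfer (simp add: scaleR_2[symmetric])

lemma hamiltonian_vf:
  "hamiltonian_vf a = (\<lambda>\<xi>\<in>T1. - lie_prod a \<xi>)"
  "hamiltonian_vf a \<in> vf_T1"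
  "vf1_apply (hamiltonian_vf a) (restrict (obs c) T1) = restrict (obs (lie_prod a c)) T1"
proof -
  define X where "X = (\<lambda>\<xi>\<in>T1. - lie_prod a \<xi>)"
  have "smooth (\<lambda>\<xi>. - lie_prod a \<xi>)"
    by (simp add: smooth_def Cn_linear bounded_linear_minus bounded_linear_lie_prod)
  hence X: "X \<in> vf_T1"
    by (auto simp: vf_T1_def X_def herm_trace_eq_obs obs_minus obs_lie_prod lie_prod_id)
       (simp add: obs_eq_inner)
  have a: "\<forall>c. vf1_apply X (restrict (obs c) T1) = restrict (obs (lie_prod a c)) T1"
    unfolding vf1_apply_obs[OF X] by (auto simp: X_def obs_minus obs_lie_prod)
  have "hamiltonian_vf a = X"
    unfolding hamiltonian_vf_def
    by (rule the_equality) (use X a in blast, rule vf_T1_ext, use X a in auto)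
  thus "hamiltonian_vf a = (\<lambda>\<xi>\<in>T1. - lie_prod a \<xi>)" "hamiltonian_vf a \<in> vf_T1"
    "vf1_apply (hamiltonian_vf a) (restrict (obs c) T1) = restrict (obs (lie_prod a c)) T1"
    using X a X_def by auto
qed

lemma gradient_vf:
  "gradient_vf b = (\<lambda>\<xi>\<in>T1. jordan_prod b \<xi> - obs b \<xi> *\<^sub>R \<xi>)"
  "gradient_vf b \<in> vf_T1"
  "vf1_apply (gradient_vf b) (restrict (obs c) T1) =
     (\<lambda>\<xi>\<in>T1. obs (jordan_prod b c) \<xi> - obs b \<xi> * obs c \<xi>)"
proof -
  define Y where "Y = (\<lambda>\<xi>\<in>T1. jordan_prod b \<xi> - obs b \<xi> *\<^sub>R \<xi>)"
  have "Cn k (\<lambda>\<xi>. jordan_prod b \<xi> + obs b \<xi> *\<^sub>R (- \<xi>))" for k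
    by (intro Cn_add Cn_scaleR Cn_linear bounded_linear_jordan_prod bounded_linear_obs
        bounded_linear_minus bounded_linear_ident)
  hence "smooth (\<lambda>\<xi>. jordan_prod b \<xi> - obs b \<xi> *\<^sub>R \<xi>)" by (simp add: smooth_def)
  hence Y: "Y \<in> vf_T1"
    by (auto simp: vf_T1_def Y_def herm_trace_eq_obs obs_diff obs_scaleR obs_jordan_prod
        jordan_prod_id T1_def)
  have a: "\<forall>c. vf1_apply Y (restrict (obs c) T1) =
      (\<lambda>\<xi>\<in>T1. obs (jordan_prod b c) \<xi> - obs b \<xi> * obs c \<xi>)"
    unfolding vf1_apply_obs[OF Y] by (auto simp: Y_def obs_diff obs_scaleR obs_jordan_prod)
  have "gradient_vf b = Y"
    unfolding gradient_vf_def
    by (rule the_equality) (use Y a in blast, rule vf_T1_ext, use Y a in auto)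
  thus "gradient_vf b = (\<lambda>\<xi>\<in>T1. jordan_prod b \<xi> - obs b \<xi> *\<^sub>R \<xi>)" "gradient_vf b \<in> vf_T1"
    "vf1_apply (gradient_vf b) (restrict (obs c) T1) =
     (\<lambda>\<xi>\<in>T1. obs (jordan_prod b c) \<xi> - obs b \<xi> * obs c \<xi>)"
    using Y a Y_def by auto
qed

end

theory Submission
  imports Defs
begin

text \<open>
  In any orthonormal basis the coordinate field of a linear map is the map itself, so the field of
  the generator is \<open>gkls\<close>. It is traceless because \<open>Tr (K \<xi>) = Tr (V \<xi>)\<close>, hence tangent
  to \<open>T1\<close>. The jump field is \<open>K \<xi> - Tr (V \<xi>) \<xi>\<close> on \<open>T1\<close>, and its quadratic term cancels the
  one of the gradient-like field of \<open>- V\<close>, so the three fields add up to \<open>gkls\<close>.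
\<close>

section \<open>Smooth functions and tangent fields\<close>

text \<open>A bounded linear map commutes with directional derivatives, so every directional
  derivative of the composite has the same form and the induction closes.\<close>

lemma Cn_bounded_linear_compose:
  assumes L: "bounded_linear L" and "Cn k f"
  shows "Cn k (\<lambda>x. L (f x))"
  using assms(2)
proof (induction k arbitrary: f)
  case 0
  thus ?case using L by (simp add: bounded_linear.continuous_on)
next
  case (Suc k)
  have d: "((\<lambda>x. L (f x)) has_derivative (\<lambda>h. L (frechet_derivative f (at x) h))) (at x)" for x
    using Suc.prems by (intro bounded_linear.has_derivative[OF L]) (auto simp: frechet_derivative_works)
  show ?case
    using Suc d frechet_derivative_at[OF d, symmetric] by (auto simp: differentiable_def)
qed

lemma Cn_sum:
  assumes "\<And>i. i \<in> I \<Longrightarrow> Cn k (f i)"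
  shows "Cn k (\<lambda>x. \<Sum>i\<in>I. f i x)"
  using assms by (induction I rule: infinite_finite_induct) (simp_all add: Cn_const Cn_add)

lemma smooth_add: "smooth f \<Longrightarrow> smooth g \<Longrightarrow> smooth (\<lambda>x. f x + g x)"
  by (simp add: smooth_def Cn_add)

lemma smooth_scaleR: "smooth f \<Longrightarrow> smooth g \<Longrightarrow> smooth (\<lambda>x. f x *\<^sub>R g x)"
  by (simp add: smooth_def Cn_scaleR)

lemma smooth_mult: "smooth f \<Longrightarrow> smooth g \<Longrightarrow> smooth (\<lambda>x. f x * g x)"
  for f g :: "'a::euclidean_space \<Rightarrow> real"
  using smooth_scaleR[of f g] by simp

lemma smooth_cmult: "smooth f \<Longrightarrow> smooth (\<lambda>x. r * f x)"
  for f :: "'a::euclidean_space \<Rightarrow> real"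
  using smooth_mult[of "\<lambda>_. r" f] by (simp add: smooth_def Cn_const)

lemma smooth_bounded_linear: "bounded_linear f \<Longrightarrow> smooth f"
  by (simp add: smooth_def Cn_linear)

lemma smooth_imp_has_derivative:
  assumes "smooth f"
  shows "(f has_derivative frechet_derivative f (at x)) (at x)"
proof -
  have "Cn (Suc 0) f" using assms unfolding smooth_def by blast
  thus ?thesis by (simp add: frechet_derivative_works)
qed

text \<open>\<open>Cn\<close> speaks of derivatives in a fixed direction, while here the direction
  varies with the point. Expanding \<open>V \<xi>\<close> in \<open>Basis\<close> gives a finite sum
  of smooth coefficients times derivatives in fixed directions.\<close>

lemma smooth_vf_apply:
  assumes f: "smooth f" and V: "smooth V"
  shows "smooth (vf_apply V f)"
  unfolding smooth_def
proof
  fix k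
  have "vf_apply V f = (\<lambda>\<xi>. \<Sum>b\<in>Basis. (V \<xi> \<bullet> b) *\<^sub>R frechet_derivative f (at \<xi>) b)"
  proof
    fix \<xi>
    have l: "linear (frechet_derivative f (at \<xi>))"
      using smooth_imp_has_derivative[OF f] has_derivative_linear by blast
    have "frechet_derivative f (at \<xi>) (V \<xi>)
        = frechet_derivative f (at \<xi>) (\<Sum>b\<in>Basis. (V \<xi> \<bullet> b) *\<^sub>R b)"
      by (simp only: euclidean_representation)
    also have "\<dots> = (\<Sum>b\<in>Basis. (V \<xi> \<bullet> b) *\<^sub>R frechet_derivative f (at \<xi>) b)"
      by (simp only: linear_sum[OF l] linear_cmul[OF l])
    finally show "vf_apply V f \<xi> = (\<Sum>b\<in>Basis. (V \<xi> \<bullet> b) *\<^sub>R frechet_derivative f (at \<xi>) b)"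
      by (simp only: vf_apply_def)
  qed
  moreover have "Cn k (\<lambda>\<xi>. \<Sum>b\<in>Basis. (V \<xi> \<bullet> b) *\<^sub>R frechet_derivative f (at \<xi>) b)"
  proof (intro Cn_sum Cn_scaleR)
    fix b
    show "Cn k (\<lambda>\<xi>. V \<xi> \<bullet> b)"
      using V unfolding smooth_def by (blast intro: Cn_bounded_linear_compose[OF bounded_linear_inner_left])
    \<comment> \<open>One extra order of differentiability of \<open>f\<close> pays for the
      derivative taken.\<close>
    have "Cn (Suc k) f" using f unfolding smooth_def by blast
    thus "Cn k (\<lambda>\<xi>. frechet_derivative f (at \<xi>) b)" by simp
  qed
  ultimately show "Cn k (vf_apply V f)" by simp
qed

lemma vf_apply_eqI: "(f has_derivative f') (at \<xi>) \<Longrightarrow> vf_apply V f \<xi> = f' (V \<xi>)"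
  unfolding vf_apply_def by (drule frechet_derivative_at) simp

lemma vf_apply_add:
  assumes "smooth f" "smooth g"
  shows "vf_apply V (\<lambda>\<xi>. f \<xi> + g \<xi>) \<xi> = vf_apply V f \<xi> + vf_apply V g \<xi>"
  using vf_apply_eqI[OF has_derivative_add[OF smooth_imp_has_derivative[OF assms(1), of \<xi>]
        smooth_imp_has_derivative[OF assms(2), of \<xi>]]]
  unfolding vf_apply_def .

lemma vf_apply_mult:
  assumes "smooth f" "smooth g"
  shows "vf_apply V (\<lambda>\<xi>. f \<xi> * g \<xi>) \<xi> = vf_apply V f \<xi> * g \<xi> + f \<xi> * vf_apply V g \<xi>"
  using vf_apply_eqI[OF has_derivative_mult[OF smooth_imp_has_derivative[OF assms(1), of \<xi>]
        smooth_imp_has_derivative[OF assms(2), of \<xi>]]]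
  unfolding vf_apply_def by (simp only: add.commute)

lemma vf_apply_cmult:
  assumes "smooth f"
  shows "vf_apply V (\<lambda>\<xi>. r * f \<xi>) \<xi> = r * vf_apply V f \<xi>"
  using vf_apply_eqI[OF has_derivative_mult_right[OF smooth_imp_has_derivative[OF assms, of \<xi>]]]
  unfolding vf_apply_def .

section \<open>Tangent fields as derivations of the functions on the hyperplane\<close>

lemma vf_T1I:
  assumes "smooth V" "\<And>\<xi>. \<xi> \<in> T1 \<Longrightarrow> herm_trace (V \<xi>) = 0"
  shows "restrict V T1 \<in> vf_T1"
  using assms by (auto simp: vf_T1_def)

text \<open>Chain rule along the line \<open>\<xi> + t X \<xi>\<close>: it stays in
  \<open>T1\<close> because \<open>X \<xi>\<close> is traceless, so the restriction of
  \<open>f\<close> is invisible along it.\<close>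

lemma vf1_apply_restrict:
  assumes f: "smooth f" and X: "X \<in> vf_T1"
  shows "vf1_apply X (restrict f T1) = restrict (vf_apply X f) T1"
proof -
  have "deriv (\<lambda>t. restrict f T1 (\<xi> + t *\<^sub>R X \<xi>)) 0 = vf_apply X f \<xi>" if "\<xi> \<in> T1" for \<xi>
  proof -
    have "\<xi> + t *\<^sub>R X \<xi> \<in> T1" for t
      using X that by (auto simp: vf_T1_def T1_def herm_trace_eq_obs obs_add obs_scaleR)
    hence eq: "(\<lambda>t. restrict f T1 (\<xi> + t *\<^sub>R X \<xi>)) = (\<lambda>t. f (\<xi> + t *\<^sub>R X \<xi>))" by simp
    have g: "((\<lambda>t. \<xi> + t *\<^sub>R X \<xi>) has_derivative (\<lambda>t. t *\<^sub>R X \<xi>)) (at 0)"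
      by (auto intro!: derivative_eq_intros)
    \<comment> \<open>The base point is written as the value of the line at 0, the form in which the
      chain rule matches.\<close>
    have f': "(f has_derivative frechet_derivative f (at \<xi>)) (at (\<xi> + 0 *\<^sub>R X \<xi>))"
      using smooth_imp_has_derivative[OF f, of \<xi>] by simp
    have "((\<lambda>t. f (\<xi> + t *\<^sub>R X \<xi>)) has_derivative (\<lambda>t. frechet_derivative f (at \<xi>) (t *\<^sub>R X \<xi>))) (at 0)"
      using has_derivative_compose[OF g f'] .
    moreover have "frechet_derivative f (at \<xi>) (t *\<^sub>R X \<xi>) = vf_apply X f \<xi> * t" for t
      using linear_cmul[OF has_derivative_linear[OF smooth_imp_has_derivative[OF f]]]
      by (simp add: vf_apply_def)
    ultimately have "((\<lambda>t. f (\<xi> + t *\<^sub>R X \<xi>)) has_real_derivative vf_apply X f \<xi>) (at 0)"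
      by (simp add: has_field_derivative_def)
    thus ?thesis unfolding eq by (rule DERIV_imp_deriv)
  qed
  thus ?thesis by (auto simp: vf1_apply_def restrict_def)
qed

lemma restrict_op_restrict:
  "(\<lambda>\<xi>\<in>A. restrict f A \<xi> + restrict g A \<xi>) = restrict (\<lambda>\<xi>. f \<xi> + g \<xi>) A"
  "(\<lambda>\<xi>\<in>A. r * restrict f A \<xi>) = restrict (\<lambda>\<xi>. r * f \<xi>) A"
  "(\<lambda>\<xi>\<in>A. restrict f A \<xi> * restrict g A \<xi>) = restrict (\<lambda>\<xi>. f \<xi> * g \<xi>) A"
  by (auto simp: restrict_def)

text \<open>Elements of \<open>F_T1\<close> are restrictions of smooth functions, on which the
  action of \<open>X\<close> is the restricted action of a first-order operator; the laws are
  inherited from that operator.\<close>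

lemma derivation_T1_vf1_apply:
  assumes X: "X \<in> vf_T1"
  shows "derivation_T1 (vf1_apply X)"
proof -
  obtain V where V: "smooth V" and XV: "X = restrict V T1"
    using X by (auto simp: vf_T1_def)
  have "vf1_apply X (restrict f T1) \<in> F_T1" if "smooth f" for f
  proof -
    \<comment> \<open>\<open>X\<close> is \<open>undefined\<close> off \<open>T1\<close>, so
      \<open>vf_apply X f\<close> need not be smooth; the smooth extension \<open>V\<close> supplies
      a representative in \<open>F_dual\<close>.\<close>
    have "vf1_apply X (restrict f T1) = restrict (vf_apply V f) T1"
      unfolding vf1_apply_restrict[OF that X] by (auto simp: XV vf_apply_def)
    thus ?thesis
      using smooth_vf_apply[OF that V] by (auto simp: F_T1_def F_dual_def)
  qed
  moreover have "vf1_apply X (\<lambda>\<xi>\<in>T1. restrict f T1 \<xi> + restrict g T1 \<xi>)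
      = (\<lambda>\<xi>\<in>T1. vf1_apply X (restrict f T1) \<xi> + vf1_apply X (restrict g T1) \<xi>)"
    if "smooth f" "smooth g" for f g
    unfolding restrict_op_restrict vf1_apply_restrict[OF that(1) X] vf1_apply_restrict[OF that(2) X]
      vf1_apply_restrict[OF smooth_add[OF that] X]
    by (auto simp: vf_apply_add[OF that])
  moreover have "vf1_apply X (\<lambda>\<xi>\<in>T1. r * restrict f T1 \<xi>)
      = (\<lambda>\<xi>\<in>T1. r * vf1_apply X (restrict f T1) \<xi>)"
    if "smooth f" for f r
    unfolding restrict_op_restrict vf1_apply_restrict[OF that X]
      vf1_apply_restrict[OF smooth_cmult[OF that] X]
    by (auto simp: vf_apply_cmult[OF that])
  moreover have "vf1_apply X (\<lambda>\<xi>\<in>T1. restrict f T1 \<xi> * restrict g T1 \<xi>)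
      = (\<lambda>\<xi>\<in>T1. vf1_apply X (restrict f T1) \<xi> * restrict g T1 \<xi>
                 + restrict f T1 \<xi> * vf1_apply X (restrict g T1) \<xi>)"
    if "smooth f" "smooth g" for f g
    unfolding restrict_op_restrict vf1_apply_restrict[OF that(1) X] vf1_apply_restrict[OF that(2) X]
      vf1_apply_restrict[OF smooth_mult[OF that] X]
    by (auto simp: vf_apply_mult[OF that])
  ultimately show ?thesis
    unfolding derivation_T1_def F_T1_def F_dual_def by blast
qed

text \<open>On \<open>T1\<close> a tangent ambient field sees only the restriction of
  \<open>f\<close>. Invariance of the ideal and independence of the representative both rest on
  this.\<close>

lemma vf_apply_tangent:
  assumes "smooth f" "smooth V" "\<And>\<xi>. \<xi> \<in> T1 \<Longrightarrow> herm_trace (V \<xi>) = 0"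
  shows "restrict (vf_apply V f) T1 = vf1_apply (restrict V T1) (restrict f T1)"
  using vf1_apply_restrict[OF assms(1) vf_T1I[OF assms(2,3)]] by (auto simp: vf_apply_def)

text \<open>A function in the ideal has the same restriction as the zero function, so a tangent
  field sends both to functions that agree on \<open>T1\<close>.\<close>

lemma defines_derivationI:
  assumes V: "smooth V" "\<And>\<xi>. \<xi> \<in> T1 \<Longrightarrow> herm_trace (V \<xi>) = 0"
  shows "defines_derivation V"
proof -
  have "vf_apply V f \<in> ideal_T1" if "f \<in> ideal_T1" for f
  proof -
    have f: "smooth f" and z: "\<forall>\<xi>\<in>T1. f \<xi> = 0"
      using that by (auto simp: ideal_T1_def F_dual_def)
    have sz: "smooth (\<lambda>\<xi>::'a herm. 0::real)" by (simp add: smooth_def Cn_const)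
    have "restrict f T1 = restrict (\<lambda>\<xi>. 0) T1" using z by auto
    hence "restrict (vf_apply V f) T1 = restrict (vf_apply V (\<lambda>\<xi>. 0)) T1"
      by (simp only: vf_apply_tangent[OF f V] vf_apply_tangent[OF sz V])
    hence "vf_apply V f \<xi> = 0" if "\<xi> \<in> T1" for \<xi>
      using that by (auto simp: vf_apply_def dest: fun_cong[of _ _ \<xi>])
    thus ?thesis
      using smooth_vf_apply[OF f V(1)] by (auto simp: ideal_T1_def F_dual_def)
  qed
  thus ?thesis using V(1) by (auto simp: defines_derivation_def)
qed

text \<open>The representative picked by \<open>SOME\<close> restricts to \<open>F\<close>, and
  nothing else about it matters for a tangent field.\<close>

lemma induced_derivation_eq:
  assumes V: "smooth V" "\<And>\<xi>. \<xi> \<in> T1 \<Longrightarrow> herm_trace (V \<xi>) = 0" and F: "F \<in> F_T1"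
  shows "induced_derivation V F = vf1_apply (restrict V T1) F"
proof -
  define f where "f = (SOME f. f \<in> F_dual \<and> restrict f T1 = F)"
  have "\<exists>f. f \<in> F_dual \<and> restrict f T1 = F" using F by (auto simp: F_T1_def)
  from someI_ex[OF this] have f: "f \<in> F_dual" "restrict f T1 = F" by (simp_all add: f_def)
  have "induced_derivation V F = restrict (vf_apply V f) T1"
    by (simp only: induced_derivation_def f_def)
  also have "\<dots> = vf1_apply (restrict V T1) F"
    using vf_apply_tangent[OF _ V, of f] f by (simp add: F_dual_def)
  finally show ?thesis .
qed

text \<open>\<open>D\<close> and \<open>E\<close> are compared on \<open>F_T1\<close> only, so the
  laws transfer once \<open>F_T1\<close> is known to be closed under sums, real multiples and
  products.\<close>

lemma derivation_T1_cong:
  assumes "\<And>F. F \<in> F_T1 \<Longrightarrow> D F = E F" "derivation_T1 E"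
  shows "derivation_T1 D"
proof -
  have "(\<lambda>\<xi>\<in>T1. F \<xi> + G \<xi>) \<in> F_T1" "(\<lambda>\<xi>\<in>T1. r * F \<xi>) \<in> F_T1" "(\<lambda>\<xi>\<in>T1. F \<xi> * G \<xi>) \<in> F_T1"
    if FG: "F \<in> F_T1" "G \<in> F_T1" for F G :: "'a herm \<Rightarrow> real" and r
  proof -
    obtain f g where f: "smooth f" "F = restrict f T1" and g: "smooth g" "G = restrict g T1"
      using FG by (auto simp: F_T1_def F_dual_def)
    show "(\<lambda>\<xi>\<in>T1. F \<xi> + G \<xi>) \<in> F_T1" "(\<lambda>\<xi>\<in>T1. r * F \<xi>) \<in> F_T1"
      "(\<lambda>\<xi>\<in>T1. F \<xi> * G \<xi>) \<in> F_T1"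
      unfolding f(2) g(2) restrict_op_restrict F_T1_def F_dual_def
      using f(1) g(1) by (blast intro: smooth_add smooth_cmult smooth_mult)+
  qed
  with assms show ?thesis unfolding derivation_T1_def by simp
qed

section \<open>The generator in Cartesian coordinates\<close>

text \<open>Both equations are tested against all \<open>e \<nu>\<close>: these span the space, so a
  vector orthogonal to each of them is orthogonal to itself and vanishes.\<close>

lemma
  fixes e d :: "nat \<Rightarrow> 'n::finite herm"
  assumes e: "trace_orthonormal_basis e" and d: "dual_basis e d"
  shows dual_basis_eq: "\<mu> < CARD('n)\<^sup>2 \<Longrightarrow> d \<mu> = e \<mu>"
    and dual_basis_expansion: "(\<Sum>\<mu><CARD('n)\<^sup>2. obs (e \<mu>) \<xi> *\<^sub>R d \<mu>) = \<xi>"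
proof -
  have zero: "x = 0" if "\<And>\<nu>. \<nu> < CARD('n)\<^sup>2 \<Longrightarrow> obs (e \<nu>) x = 0" for x
  proof -
    have "x \<in> span (e ` {..<CARD('n)\<^sup>2})" using e by (simp add: trace_orthonormal_basis_def)
    moreover have "orthogonal x b" if "b \<in> e ` {..<CARD('n)\<^sup>2}" for b
      using that \<open>\<And>\<nu>. \<nu> < CARD('n)\<^sup>2 \<Longrightarrow> obs (e \<nu>) x = 0\<close> by (auto simp: orthogonal_def obs_eq_inner)
    ultimately have "orthogonal x x" by (rule orthogonal_to_span)
    thus ?thesis by (simp add: orthogonal_def)
  qed
  have ed: "obs (e \<nu>) (d \<mu>) = (if \<mu> = \<nu> then 1 else 0)" if "\<mu> < CARD('n)\<^sup>2" "\<nu> < CARD('n)\<^sup>2" for \<mu> \<nu>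
    using d that by (simp add: dual_basis_def)
  have ee: "obs (e \<nu>) (e \<mu>) = (if \<mu> = \<nu> then 1 else 0)" if "\<mu> < CARD('n)\<^sup>2" "\<nu> < CARD('n)\<^sup>2" for \<mu> \<nu>
    using e that by (simp add: trace_orthonormal_basis_def obs_def)
  show "d \<mu> = e \<mu>" if "\<mu> < CARD('n)\<^sup>2"
    using zero[of "d \<mu> - e \<mu>"] that by (simp add: obs_diff ed ee)
  have "(\<Sum>\<mu><CARD('n)\<^sup>2. obs (e \<mu>) \<xi> *\<^sub>R d \<mu>) - \<xi> = 0"
  proof (rule zero)
    fix \<nu> assume \<nu>: "\<nu> < CARD('n)\<^sup>2"
    have "obs (e \<nu>) (\<Sum>\<mu><CARD('n)\<^sup>2. obs (e \<mu>) \<xi> *\<^sub>R d \<mu>)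
        = (\<Sum>\<mu><CARD('n)\<^sup>2. obs (e \<mu>) \<xi> * obs (e \<nu>) (d \<mu>))"
      by (simp add: obs_eq_inner inner_sum_left)
    also have "\<dots> = (\<Sum>\<mu><CARD('n)\<^sup>2. if \<mu> = \<nu> then obs (e \<mu>) \<xi> else 0)"
      by (intro sum.cong) (auto simp: ed \<nu>)
    finally show "obs (e \<nu>) ((\<Sum>\<mu><CARD('n)\<^sup>2. obs (e \<mu>) \<xi> *\<^sub>R d \<mu>) - \<xi>) = 0"
      using \<nu> by (simp add: obs_diff)
  qed
  thus "(\<Sum>\<mu><CARD('n)\<^sup>2. obs (e \<mu>) \<xi> *\<^sub>R d \<mu>) = \<xi>" by simp
qed

text \<open>Apply the linear functional \<open>obs a\<close> after \<open>A\<close> to the basis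
  expansion of \<open>\<xi>\<close>. With \<open>a = e \<mu>\<close> this is the contraction of
  matrix entries with coordinates that occurs in the linear field and in the jump field.\<close>

lemma obs_linear_expansion:
  fixes e d :: "nat \<Rightarrow> 'n::finite herm"
  assumes "trace_orthonormal_basis e" "dual_basis e d" and A: "linear A"
  shows "(\<Sum>\<nu><CARD('n)\<^sup>2. obs a (A (d \<nu>)) * obs (e \<nu>) \<xi>) = obs a (A \<xi>)"
proof -
  have "obs a (A (\<Sum>\<nu><CARD('n)\<^sup>2. obs (e \<nu>) \<xi> *\<^sub>R d \<nu>))
      = (\<Sum>\<nu><CARD('n)\<^sup>2. obs a (A (d \<nu>)) * obs (e \<nu>) \<xi>)"
    by (simp add: linear_sum[OF A] linear_cmul[OF A] obs_eq_inner inner_sum_left mult.commute)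
  thus ?thesis by (simp only: dual_basis_expansion[OF assms(1,2)])
qed

text \<open>The inner sum is the coordinate of \<open>A \<xi>\<close> along \<open>d \<mu>\<close>,
  and the outer sum reassembles \<open>A \<xi>\<close>.\<close>

lemma linear_vf_eq:
  assumes "trace_orthonormal_basis e" "dual_basis e d" "linear A"
  shows "linear_vf e d A = A"
  by (rule ext) (simp only: linear_vf_def scaleR_left.sum[symmetric]
      obs_linear_expansion[OF assms] dual_basis_expansion[OF assms(1,2)])

text \<open>Omitting the index 0 removes the component along the identity, which leaves the
  orthogonal projection onto the traceless matrices.\<close>

lemma traceless_expansion:
  fixes e d :: "nat \<Rightarrow> 'n::finite herm"
  assumes "trace_orthonormal_basis e" "dual_basis e d"
    and e0: "e 0 = (1 / sqrt (real CARD('n))) *\<^sub>R id_herm"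
  shows "(\<Sum>k=1..<CARD('n)\<^sup>2. obs (e k) \<xi> *\<^sub>R d k)
    = \<xi> - (herm_trace \<xi> / real CARD('n)) *\<^sub>R id_herm"
proof -
  have n: "0 < CARD('n)\<^sup>2" by (simp add: power2_eq_square)
  have "\<xi> = (\<Sum>\<mu>=0..<CARD('n)\<^sup>2. obs (e \<mu>) \<xi> *\<^sub>R d \<mu>)"
    using dual_basis_expansion[OF assms(1,2)] by (simp add: lessThan_atLeast0)
  also have "\<dots> = obs (e 0) \<xi> *\<^sub>R e 0 + (\<Sum>k=1..<CARD('n)\<^sup>2. obs (e k) \<xi> *\<^sub>R d k)"
    using n by (simp add: sum.atLeast_Suc_lessThan dual_basis_eq[OF assms(1,2)])
  \<comment> \<open>The coordinate and the basis vector each contribute a factor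
    \<open>1 / sqrt n\<close>.\<close>
  also have "obs (e 0) \<xi> *\<^sub>R e 0 = (herm_trace \<xi> / real CARD('n)) *\<^sub>R id_herm"
    by (simp add: e0 obs_eq_inner herm_trace_eq_obs)
  finally show ?thesis by (simp add: algebra_simps)
qed

section \<open>Linearity and trace of the generator, and the jump field without coordinates\<close>

lemma linear_kraus_map: "linear (kraus_map v N)"
proof (rule linearI)
  show "kraus_map v N (x + y) = kraus_map v N x + kraus_map v N y" for x y
    by transfer (simp add: matrix_mult_distribs sum.distrib)
  show "kraus_map v N (r *\<^sub>R x) = r *\<^sub>R kraus_map v N x" for r x
    by transfer (simp add: matrix_scaleR_left matrix_scaleR_right scaleR_sum_right)
qed

text \<open>Cyclicity of the trace, applied to each jump operator separately.\<close>

lemma herm_trace_kraus_map: "herm_trace (kraus_map v N \<xi>) = obs (kraus_sum v N) \<xi>"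
proof -
  have s: "trace (\<Sum>j\<in>I. M j) = (\<Sum>j\<in>I. trace (M j))" for I and M :: "nat \<Rightarrow> complex^'a^'a"
    by (induction I rule: infinite_finite_induct) (simp_all add: trace_add trace_0[unfolded mat_0])
  have m: "A ** (\<Sum>j\<in>I. M j) = (\<Sum>j\<in>I. A ** M j)" for I A and M :: "nat \<Rightarrow> complex^'a^'a"
    by (induction I rule: infinite_finite_induct) (auto simp: matrix_add_ldistrib)
  have "trace (v j ** mat_of \<xi> ** dagger (v j)) = trace (mat_of \<xi> ** (dagger (v j) ** v j))" for j
    using trace_mul_sym[of "v j" "mat_of \<xi> ** dagger (v j)"] by (simp add: matrix_mul_assoc)
  thus ?thesis
    by (simp add: herm_trace_def obs_def kraus_map.rep_eq kraus_sum.rep_eq s m)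
qed

lemma linear_gkls: "linear (gkls H v N)"
  unfolding gkls_def[abs_def]
  using bounded_linear.linear[OF bounded_linear_lie_prod] bounded_linear.linear[OF bounded_linear_jordan_prod]
    linear_kraus_map
  by (intro linear_compose_add linear_compose_sub linear_compose_neg linear_compose_scale_right) auto

text \<open>The trace is the pairing with the identity. Moving the products onto the identity kills
  the commutator term and turns the Jordan term into minus the pairing with
  \<open>kraus_sum v N\<close>, which the jump term restores.\<close>

lemma herm_trace_gkls: "herm_trace (gkls H v N \<xi>) = 0"
proof -
  have "obs id_herm (kraus_map v N \<xi>) = obs (kraus_sum v N) \<xi>"
    using herm_trace_kraus_map[of v N \<xi>] by (simp only: herm_trace_eq_obs)
  thus ?thesis
    by (simp add: gkls_def herm_trace_eq_obs obs_add obs_diff obs_minus obs_scaleR obs_lie_prod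
        obs_jordan_prod lie_prod_id jordan_prod_id) (simp add: obs_eq_inner)
qed

text \<open>Both sums over \<open>k \<ge> 1\<close> are traceless projections. They drop
  \<open>Tr (K \<xi>) / n\<close> and \<open>obs V \<xi> * Tr \<xi> / n\<close> times the identity;
  on \<open>T1\<close> these are equal, hence cancel in the difference.\<close>

lemma jump_vf_eq:
  fixes e d :: "nat \<Rightarrow> 'n::finite herm"
  assumes "trace_orthonormal_basis e" "dual_basis e d"
    and "e 0 = (1 / sqrt (real CARD('n))) *\<^sub>R id_herm"
    and K: "linear K" "\<And>\<xi>. herm_trace (K \<xi>) = obs V \<xi>"
  shows "jump_vf e d K V = (\<lambda>\<xi>\<in>T1. K \<xi> - obs V \<xi> *\<^sub>R \<xi>)"
proof (unfold jump_vf_def dilation_vf_def, rule restrict_ext)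
  fix \<xi> :: "'n herm" assume \<xi>: "\<xi> \<in> T1"
  show "(\<Sum>k=1..<CARD('n)\<^sup>2. \<Sum>\<mu><CARD('n)\<^sup>2. (obs (e k) (K (d \<mu>)) * obs (e \<mu>) \<xi>) *\<^sub>R d k)
     - obs V \<xi> *\<^sub>R (\<lambda>\<xi>\<in>T1. \<Sum>k=1..<CARD('n)\<^sup>2. obs (e k) \<xi> *\<^sub>R d k) \<xi> = K \<xi> - obs V \<xi> *\<^sub>R \<xi>"
    unfolding scaleR_left.sum[symmetric] obs_linear_expansion[OF assms(1,2) K(1)]
      restrict_apply'[OF \<xi>] traceless_expansion[OF assms(1-3)]
    using \<xi> by (simp add: K(2) T1_def algebra_simps)
qed

section \<open>The decomposition of the field of the generator on the hyperplane\<close>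

theorem proposition7:
  fixes H :: "'n::finite herm"
    and v :: "nat \<Rightarrow> complex^'n^'n"
    and N :: nat
    and e d :: "nat \<Rightarrow> 'n herm"
  assumes "N \<le> CARD('n)\<^sup>2 - 1"
    and "trace_orthonormal_basis e"
    and "e 0 = (1 / sqrt (real CARD('n))) *\<^sub>R id_herm"
    and "dual_basis e d"
  shows "let V = kraus_sum v N;
             K = kraus_map v N;
             \<Gamma>' = linear_vf e d (gkls H v N);
             \<Gamma> = induced_derivation \<Gamma>';
             X = hamiltonian_vf (2 *\<^sub>R H);
             Y = gradient_vf (- V);
             Z = jump_vf e d K V
         in defines_derivation \<Gamma>' \<and>
            derivation_T1 \<Gamma> \<and>
            (\<forall>f\<in>F_dual. \<Gamma> (restrict f T1) = restrict (vf_apply \<Gamma>' f) T1) \<and>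
            X \<in> vf_T1 \<and> derivation_T1 (vf1_apply X) \<and>
            Y \<in> vf_T1 \<and> derivation_T1 (vf1_apply Y) \<and>
            Z \<in> vf_T1 \<and> derivation_T1 (vf1_apply Z) \<and>
            (\<forall>F\<in>F_T1. \<Gamma> F = (\<lambda>\<xi>\<in>T1. vf1_apply X F \<xi> + vf1_apply Y F \<xi> + vf1_apply Z F \<xi>))"
proof -
  define L where "L = gkls H v N"
  define V where "V = kraus_sum v N"
  define K where "K = kraus_map v N"
  define X where "X = hamiltonian_vf (2 *\<^sub>R H)"
  define Y where "Y = gradient_vf (- V)"
  define Z where "Z = jump_vf e d K V"
  have \<Gamma>: "linear_vf e d L = L"
    using assms by (simp add: L_def linear_vf_eq linear_gkls)
  have L: "smooth L" "\<And>\<xi>. herm_trace (L \<xi>) = 0"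
    by (simp_all add: L_def linear_gkls linear_linear smooth_bounded_linear herm_trace_gkls)
  have LT: "restrict L T1 \<in> vf_T1" using L by (rule vf_T1I)
  have ind: "induced_derivation L F = vf1_apply (restrict L T1) F" if "F \<in> F_T1" for F
    using L that by (intro induced_derivation_eq)
  have X: "X \<in> vf_T1" unfolding X_def by (rule hamiltonian_vf)
  have Y: "Y \<in> vf_T1" unfolding Y_def by (rule gradient_vf)
  have Zeq: "Z = (\<lambda>\<xi>\<in>T1. K \<xi> - obs V \<xi> *\<^sub>R \<xi>)"
    using assms(2-4) unfolding Z_def K_def V_def
    by (intro jump_vf_eq linear_kraus_map herm_trace_kraus_map)
  \<comment> \<open>The difference is written as a sum so that the closure rules apply; its
    quadratic term is a product of two linear maps.\<close>
  have "smooth (\<lambda>\<xi>. K \<xi> + obs V \<xi> *\<^sub>R (- \<xi>))"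
    unfolding K_def
    by (intro smooth_add smooth_scaleR smooth_bounded_linear linear_conv_bounded_linear[THEN iffD1, OF linear_kraus_map]
        bounded_linear_obs bounded_linear_minus bounded_linear_ident)
  hence Z: "Z \<in> vf_T1"
    unfolding Zeq
    by (intro vf_T1I) (use herm_trace_kraus_map[of v N] in
        \<open>auto simp: K_def V_def T1_def herm_trace_eq_obs obs_diff obs_scaleR\<close>)
  \<comment> \<open>The fields carry the factor and the sign inside the first argument,
    \<open>gkls\<close> carries them outside; the linearity shown before concerns the second
    argument.\<close>
  have lin: "lie_prod (2 *\<^sub>R H) \<xi> = 2 *\<^sub>R lie_prod H \<xi>"
    "jordan_prod (- V) \<xi> = - jordan_prod V \<xi>" for \<xi>
    by (transfer, simp add: vec_eq_iff matrix_scaleR_left matrix_scaleR_right algebra_simps)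
       (transfer, simp add: vec_eq_iff matrix_matrix_mult_def sum_negf algebra_simps)
  \<comment> \<open>\<open>X\<close> contributes \<open>- 2 lie_prod H \<xi>\<close>, since a
    Hamiltonian field takes the value \<open>- lie_prod a \<xi>\<close>. \<open>Y\<close> and
    \<open>Z\<close> carry \<open>obs V \<xi>\<close> times \<open>\<xi>\<close> with opposite
    signs.\<close>
  have LXYZ: "L \<xi> = X \<xi> + Y \<xi> + Z \<xi>" if "\<xi> \<in> T1" for \<xi>
    using that
    by (simp add: L_def X_def Y_def Zeq hamiltonian_vf gradient_vf gkls_def lin K_def)
       (simp add: V_def obs_eq_inner)
  have sum: "vf1_apply (restrict L T1) F = (\<lambda>\<xi>\<in>T1. vf1_apply X F \<xi> + vf1_apply Y F \<xi> + vf1_apply Z F \<xi>)"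
    if F: "F \<in> F_T1" for F
  proof -
    obtain f where f: "smooth f" "F = restrict f T1"
      using F by (auto simp: F_T1_def F_dual_def)
    \<comment> \<open>Linearity in the direction turns the pointwise sum of fields into the sum of
      their actions on functions.\<close>
    have l: "linear (frechet_derivative f (at \<xi>))" for \<xi>
      using smooth_imp_has_derivative[OF f(1)] has_derivative_linear by blast
    show ?thesis
      unfolding f(2) vf1_apply_restrict[OF f(1) LT] vf1_apply_restrict[OF f(1) X]
        vf1_apply_restrict[OF f(1) Y] vf1_apply_restrict[OF f(1) Z]
      by (auto simp: vf_apply_def LXYZ linear_add[OF l])
  qed
  have "derivation_T1 (induced_derivation L)"
    using ind derivation_T1_vf1_apply[OF LT] by (rule derivation_T1_cong)
  moreover have "defines_derivation L" using L by (rule defines_derivationI)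
  \<comment> \<open>Any representative computes the induced derivation: both sides equal the action
    of the restricted field on the restriction of \<open>f\<close>.\<close>
  moreover have "induced_derivation L (restrict f T1) = restrict (vf_apply L f) T1" if "f \<in> F_dual" for f
    using that L vf_apply_tangent[of f L] ind[of "restrict f T1"] by (auto simp: F_T1_def F_dual_def)
  ultimately show ?thesis
    unfolding Let_def L_def[symmetric] V_def[symmetric] K_def[symmetric] \<Gamma>
      X_def[symmetric] Y_def[symmetric] Z_def[symmetric]
    using X Y Z ind sum by (simp add: derivation_T1_vf1_apply)
qed

end
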